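(* Let $c:\mathbb{R}^n\times\mathbb{R}^m\to\mathbb{R}$ be Lipschitz continuous, with $c(\cdot,y)$ convex for every $y\in\mathbb{R}^m$ and $c(x,\cdot)$ concave for every $x\in\mathbb{R}^n$. Let $g:\mathbb{R}^n\to\mathbb{R}^{\hat n}$ and $h:\mathbb{R}^m\to\mathbb{R}^{\hat m}$ be continuously differentiable, let $X\subset\mathbb{R}^n$ and $Y\subset\mathbb{R}^m$ be nonempty, convex and compact, and let $\lambda_1,\lambda_2>0$. Then the min-max problem $$\min_{x\in X}\max_{y\in Y} f(x,y):=c(x,y)+\lambda_1\|g(x)_+\|_0-\lambda_2\|h(y)_+\|_0$$ always has a global minimax point.
   Context: For $a\in\mathbb{R}^k$, $\|a_+\|_0$ denotes the number of indices $i\in\{1,\dots,k\}$ with $a_i>0$. A point $(x^*,y^* )\in X\times Y$ is a global minimax point of the problem if for all $(x,y)\in X\times Y$, $$f(x^*,y)\le f(x^*,y^* )\le \max_{y'\in Y} f(x,y').$$ *)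

theory Defs
  imports "HOL-Analysis.Analysis"
begin

text \<open>The quantity \<open>\<parallel>a\<^sub>+\<parallel>\<^sub>0\<close>.\<close>

definition pos_l0 :: "real ^ 'k \<Rightarrow> nat"
  where "pos_l0 a = card {i. a $ i > 0}"

text \<open>Continuity of the derivative is with respect to the operator norm.\<close>

definition continuously_differentiable ::
    "('a::real_normed_vector \<Rightarrow> 'b::real_normed_vector) \<Rightarrow> bool"
  where "continuously_differentiable g \<longleftrightarrow>
    (\<exists>g' :: 'a \<Rightarrow> 'a \<Rightarrow>\<^sub>L 'b.
      (\<forall>x. (g has_derivative blinfun_apply (g' x)) (at x)) \<and> continuous_on UNIV g')"

text \<open>
  The condition \<open>f (xs, ys) \<le> max {f (x, y') | y' \<in> Y}\<close> is rendered as: the maximum is attained,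
  at some \<open>y'\<close>, and its value \<open>f (x, y')\<close> is at least \<open>f (xs, ys)\<close>. Writing it with a real-valued
  \<^const>\<open>Sup\<close> would leave it without meaning for unbounded functions.
\<close>

definition global_minimax_point ::
    "'a set \<Rightarrow> 'b set \<Rightarrow> ('a \<times> 'b \<Rightarrow> real) \<Rightarrow> 'a \<times> 'b \<Rightarrow> bool"
  where "global_minimax_point X Y f p \<longleftrightarrow>
    (case p of (xs, ys) \<Rightarrow>
      xs \<in> X \<and> ys \<in> Y \<and>
      (\<forall>x\<in>X. \<forall>y\<in>Y.
        f (xs, y) \<le> f (xs, ys) \<and>
        (\<exists>y'. is_arg_max (\<lambda>y. f (x, y)) (\<lambda>y. y \<in> Y) y' \<and> f (xs, ys) \<le> f (x, y'))))"

end

theory Submission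
  imports Defs
begin

text \<open>
  The counting term of \<open>x\<close> is lower semicontinuous, because a positive component stays positive under
  small perturbations; the counting term of \<open>y\<close> enters with a negative sign. As \<open>c\<close> is continuous,
  the objective is therefore lower semicontinuous in \<open>x\<close> and upper semicontinuous in \<open>y\<close>. The second
  property and compactness of \<open>Y\<close> give a maximiser \<open>Mx x\<close> of the inner problem for each \<open>x\<close>. The value
  function, being a pointwise supremum of lower semicontinuous functions, is itself lower
  semicontinuous, so it has a minimiser \<open>xs\<close> on the compact set \<open>X\<close>. The pair \<open>(xs, Mx xs)\<close> is a
  global minimax point: \<open>Mx xs\<close> answers \<open>xs\<close> optimally, and since this notion lets the maximising
  player respond to each \<open>x\<close>, the other inequality says that \<open>xs\<close> minimises the value function.
\<close>

definition lower_semicontinuous_on ::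
    "'a::topological_space set \<Rightarrow> ('a \<Rightarrow> real) \<Rightarrow> bool"
  where "lower_semicontinuous_on S f \<longleftrightarrow>
    (\<forall>x\<in>S. \<forall>r<f x. \<forall>\<^sub>F z in at x within S. r < f z)"

lemma lower_semicontinuous_onI:
  assumes "\<And>x r. x \<in> S \<Longrightarrow> r < f x \<Longrightarrow> \<forall>\<^sub>F z in at x within S. r < f z"
  shows "lower_semicontinuous_on S f"
  using assms unfolding lower_semicontinuous_on_def by blast

lemma lower_semicontinuous_onD:
  assumes "lower_semicontinuous_on S f" and "x \<in> S" and "r < f x"
  shows "\<forall>\<^sub>F z in at x within S. r < f z"
  using assms unfolding lower_semicontinuous_on_def by blast

lemma continuous_on_imp_lower_semicontinuous_on:
  assumes "continuous_on S f"
  shows "lower_semicontinuous_on S f"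
  using assms unfolding lower_semicontinuous_on_def continuous_on_def
  by (blast intro: order_tendstoD)

lemma lower_semicontinuous_on_add:
  assumes f: "lower_semicontinuous_on S f" and g: "lower_semicontinuous_on S g"
  shows "lower_semicontinuous_on S (\<lambda>x. f x + g x)"
proof (rule lower_semicontinuous_onI)
  fix x r
  assume x: "x \<in> S" and r: "r < f x + g x"
  \<comment> \<open>The slack in \<open>r < f x + g x\<close> is shared equally between the two summands.\<close>
  define e where "e = (f x + g x - r) / 2"
  have "e > 0"
    using r by (simp add: e_def)
  then have "\<forall>\<^sub>F z in at x within S. f x - e < f z"
    and "\<forall>\<^sub>F z in at x within S. g x - e < g z"
    using lower_semicontinuous_onD[OF f x] lower_semicontinuous_onD[OF g x] by simp_all
  then show "\<forall>\<^sub>F z in at x within S. r < f z + g z"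
  proof eventually_elim
    case (elim z)
    moreover have "r = (f x - e) + (g x - e)"
      by (simp add: e_def field_simps)
    ultimately show ?case
      by linarith
  qed
qed

text \<open>
  If no point were a minimiser, each \<open>x\<close> would have a strictly better point \<open>b x\<close>, and by
  semicontinuity \<open>b x\<close> would also be better than every point of a neighbourhood of \<open>x\<close>. Finitely many
  neighbourhoods cover \<open>S\<close>, and the best of the corresponding points \<open>b x\<close> lies in one of them.
\<close>

lemma lower_semicontinuous_attains_min:
  assumes S: "compact S" "S \<noteq> {}" and f: "lower_semicontinuous_on S f"
  shows "\<exists>x\<in>S. \<forall>y\<in>S. f x \<le> f y"
proof (rule ccontr)
  assume "\<not> ?thesis"
  then have "\<forall>x\<in>S. \<exists>y\<in>S. f y < f x"
    by (auto simp: not_le)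
  then obtain b where b: "\<And>x. x \<in> S \<Longrightarrow> b x \<in> S" "\<And>x. x \<in> S \<Longrightarrow> f (b x) < f x"
    by metis
  have "\<exists>U. open U \<and> x \<in> U \<and> (\<forall>z\<in>U \<inter> S. f (b x) < f z)" if "x \<in> S" for x
    using lower_semicontinuous_onD[OF f that b(2)[OF that]] b(2)[OF that]
    unfolding eventually_at_topological by (metis IntE)
  then obtain U where U: "\<And>x. x \<in> S \<Longrightarrow> open (U x)" "\<And>x. x \<in> S \<Longrightarrow> x \<in> U x"
      "\<And>x z. x \<in> S \<Longrightarrow> z \<in> U x \<Longrightarrow> z \<in> S \<Longrightarrow> f (b x) < f z"
    by (metis IntI)
  obtain T where T: "T \<subseteq> S" "finite T" "S \<subseteq> (\<Union>x\<in>T. U x)"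
    using compactE_image[OF S(1), of S U] U(1,2) by blast
  have "T \<noteq> {}"
    using T(3) S(2) by auto
  then obtain t where t: "t \<in> T" "\<And>s. s \<in> T \<Longrightarrow> f (b t) \<le> f (b s)"
    using ex_min_if_finite[of "(\<lambda>s. f (b s)) ` T"] T(2) by (auto simp: not_less)
  then obtain s where "s \<in> T" "b t \<in> U s"
    using T(1,3) b(1) by blast
  then show False
    using U(3)[of s "b t"] T(1) t b(1) by (meson not_le subsetD)
qed

text \<open>
  A set of positive components can only grow under a small perturbation, since each of its finitely
  many members persists.
\<close>

lemma lower_semicontinuous_on_pos_l0:
  fixes k :: "'a::topological_space \<Rightarrow> real ^ 'k"
  assumes "continuous_on S k" and "l \<ge> 0"
  shows "lower_semicontinuous_on S (\<lambda>x. l * real (pos_l0 (k x)))"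
proof (rule lower_semicontinuous_onI)
  fix x r
  assume x: "x \<in> S" and r: "r < l * real (pos_l0 (k x))"
  have lim: "((\<lambda>z. k z $ i) \<longlongrightarrow> k x $ i) (at x within S)" for i
    using assms(1) x by (intro tendsto_vec_nth) (auto simp: continuous_on_def)
  have "\<forall>\<^sub>F z in at x within S. \<forall>i\<in>{i. k x $ i > 0}. k z $ i > 0"
    using order_tendstoD(1)[OF lim] by (intro eventually_ball_finite) auto
  then show "\<forall>\<^sub>F z in at x within S. r < l * real (pos_l0 (k z))"
  proof eventually_elim
    case (elim z)
    then have "pos_l0 (k x) \<le> pos_l0 (k z)"
      unfolding pos_l0_def by (intro card_mono) auto
    then show ?case
      using r assms(2) by (meson less_le_trans mult_left_mono of_nat_mono)
  qed
qed

lemma continuously_differentiable_imp_continuous_on: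
  assumes "continuously_differentiable g"
  shows "continuous_on S g"
  using assms unfolding continuously_differentiable_def
  by (meson continuous_at_imp_continuous_on has_derivative_continuous)

text \<open>
  The value function inherits lower semicontinuity from the sections \<open>f (_, y)\<close>: near \<open>x\<close>
  its value at \<open>z\<close> is at least \<open>f (z, y)\<close>, where \<open>y\<close> is a fixed maximiser for \<open>x\<close>. Upper
  semicontinuity in \<open>y\<close> is stated as lower semicontinuity of the negative.
\<close>

lemma global_minimax_point_exists:
  fixes f :: "'a::topological_space \<times> 'b::topological_space \<Rightarrow> real"
  assumes X: "compact X" "X \<noteq> {}" and Y: "compact Y" "Y \<noteq> {}"
    and lsc: "\<And>y. y \<in> Y \<Longrightarrow> lower_semicontinuous_on X (\<lambda>x. f (x, y))"
    and usc: "\<And>x. x \<in> X \<Longrightarrow> lower_semicontinuous_on Y (\<lambda>y. - f (x, y))"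
  shows "\<exists>p. global_minimax_point X Y f p"
proof -
  have "\<forall>x\<in>X. \<exists>y\<in>Y. \<forall>y'\<in>Y. f (x, y') \<le> f (x, y)"
    using lower_semicontinuous_attains_min[OF Y usc] by simp
  then obtain Mx where Mx: "\<And>x. x \<in> X \<Longrightarrow> Mx x \<in> Y"
      "\<And>x y. x \<in> X \<Longrightarrow> y \<in> Y \<Longrightarrow> f (x, y) \<le> f (x, Mx x)"
    by metis
  have "lower_semicontinuous_on X (\<lambda>x. f (x, Mx x))"
  proof (rule lower_semicontinuous_onI)
    fix x r
    assume x: "x \<in> X" and r: "r < f (x, Mx x)"
    have "\<forall>\<^sub>F z in at x within X. z \<in> X"
      by (simp add: eventually_at_topological) blast
    with lower_semicontinuous_onD[OF lsc[OF Mx(1)[OF x]] x r]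
    show "\<forall>\<^sub>F z in at x within X. r < f (z, Mx z)"
    proof eventually_elim
      case (elim z)
      then show ?case
        using Mx(2)[of z "Mx x"] Mx(1)[OF x] by simp
    qed
  qed
  then obtain xs where xs: "xs \<in> X" "\<And>x. x \<in> X \<Longrightarrow> f (xs, Mx xs) \<le> f (x, Mx x)"
    using lower_semicontinuous_attains_min[OF X] by blast
  have "is_arg_max (\<lambda>y. f (x, y)) (\<lambda>y. y \<in> Y) (Mx x)" if "x \<in> X" for x
    using Mx that by (auto simp: is_arg_max_def not_less)
  then have "global_minimax_point X Y f (xs, Mx xs)"
    using xs Mx unfolding global_minimax_point_def by auto
  then show ?thesis ..
qed

theorem proposition2p1:
  fixes c :: "(real ^ 'n) \<times> (real ^ 'm) \<Rightarrow> real"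
    and g :: "real ^ 'n \<Rightarrow> real ^ 'p"
    and h :: "real ^ 'm \<Rightarrow> real ^ 'q"
    and X :: "(real ^ 'n) set"
    and Y :: "(real ^ 'm) set"
    and lam1 lam2 :: real
  assumes "\<exists>L. L-lipschitz_on UNIV c"
    and "\<And>y. convex_on UNIV (\<lambda>x. c (x, y))"
    and "\<And>x. concave_on UNIV (\<lambda>y. c (x, y))"
    and "continuously_differentiable g"
    and "continuously_differentiable h"
    and "X \<noteq> {}" and "convex X" and "compact X"
    and "Y \<noteq> {}" and "convex Y" and "compact Y"
    and "lam1 > 0" and "lam2 > 0"
  shows "\<exists>p. global_minimax_point X Y
    (\<lambda>(x, y). c (x, y) + lam1 * real (pos_l0 (g x)) - lam2 * real (pos_l0 (h y))) p"
proof (rule global_minimax_point_exists)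
  have c: "continuous_on UNIV c"
    using assms(1) lipschitz_on_continuous_on by blast
  show "lower_semicontinuous_on X (\<lambda>x. case (x, y) of (x, y) \<Rightarrow>
      c (x, y) + lam1 * real (pos_l0 (g x)) - lam2 * real (pos_l0 (h y)))" for y
  proof -
    have "continuous_on X (\<lambda>x. c (x, y) - lam2 * real (pos_l0 (h y)))"
      by (intro continuous_intros continuous_on_compose2[OF c]) auto
    then have "lower_semicontinuous_on X
        (\<lambda>x. (c (x, y) - lam2 * real (pos_l0 (h y))) + lam1 * real (pos_l0 (g x)))"
      using continuously_differentiable_imp_continuous_on[OF assms(4)] assms(12)
      by (intro lower_semicontinuous_on_add lower_semicontinuous_on_pos_l0
          continuous_on_imp_lower_semicontinuous_on[
            of _ "\<lambda>x. c (x, y) - lam2 * real (pos_l0 (h y))"]) auto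
    then show ?thesis
      by (simp add: algebra_simps)
  qed
  show "lower_semicontinuous_on Y (\<lambda>y. - (case (x, y) of (x, y) \<Rightarrow>
      c (x, y) + lam1 * real (pos_l0 (g x)) - lam2 * real (pos_l0 (h y))))" for x
  proof -
    have "continuous_on Y (\<lambda>y. - c (x, y) - lam1 * real (pos_l0 (g x)))"
      by (intro continuous_intros continuous_on_compose2[OF c]) auto
    then have "lower_semicontinuous_on Y
        (\<lambda>y. (- c (x, y) - lam1 * real (pos_l0 (g x))) + lam2 * real (pos_l0 (h y)))"
      using continuously_differentiable_imp_continuous_on[OF assms(5)] assms(13)
      by (intro lower_semicontinuous_on_add lower_semicontinuous_on_pos_l0
          continuous_on_imp_lower_semicontinuous_on[
            of _ "\<lambda>y. - c (x, y) - lam1 * real (pos_l0 (g x))"]) auto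
    then show ?thesis
      by (simp add: algebra_simps)
  qed
qed (use assms in auto)

end
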